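(* Let $K\subset\mathbb R^m$ be a smooth cone and $h:\mathbb R^n\to\mathbb R^m$ a continuously differentiable $K$-concave function, and let $S=\{x\in\mathbb R^n:h(x)\in K\}$ be nonempty. Then the inclusion $h(x)\in K$ has a local error bound at $\bar x\in S$ if and only if there exists a neighborhood $U$ of $\bar x$ such that $\mathrm{ACQ}(S\cap U)$ holds, i.e. $$h'(x)^*[N_K(h(x))]=N_S(x)\quad\text{for all }x\in S\cap U.$$
   Context: $h$ is $K$-concave if $h((1-\lambda)x+\lambda y)-[(1-\lambda)h(x)+\lambda h(y)]\in K$ for all $x,y$, $\lambda\in[0,1]$. $h'(x)^*$ is the adjoint of the Jacobian. $N_D(x)$ is the normal cone of a convex set $D$ at $x$. The inclusion has a local error bound at $\bar x\in S$ if there exist a neighborhood $U$ of $\bar x$ and $\alpha>0$ with $d(x,S)\le\alpha\, d(h(x),K)$ for all $x\in U$, where $d(x,D)=\inf_{y\in D}\|x-y\|$. A cone is regular if pointed, closed, convex, with nonempty interior. A regular cone $C$ is smooth if every boundary point of $C$ lies on an extreme ray of $C$ (a ray $\{\lambda x:\lambda\ge0\}$, $x\ne0$, which is a face of $C$, a face being a convex $\mathcal F\subset C$ such that $x,y\in C$, $\lambda x+(1-\lambda)y\in\mathcal F$ for some $0<\lambda<1$ implies $x,y\in\mathcal F$) and, for every non-zero point $x$ of any extreme ray, $N_C(x)$ has dimension one. *)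

theory Defs
  imports "HOL-Analysis.Analysis"
begin

definition normal_cone :: "'a::real_inner set \<Rightarrow> 'a \<Rightarrow> 'a set" where
  "normal_cone D x = {v. \<forall>y\<in>D. inner v (y - x) \<le> 0}"

definition K_concave :: "'b::real_vector set \<Rightarrow> ('a::real_vector \<Rightarrow> 'b) \<Rightarrow> bool" where
  "K_concave K h \<longleftrightarrow>
     (\<forall>x y. \<forall>t\<in>{0..1::real}.
        h ((1 - t) *\<^sub>R x + t *\<^sub>R y) - ((1 - t) *\<^sub>R h x + t *\<^sub>R h y) \<in> K)"

definition regular_cone :: "'a::euclidean_space set \<Rightarrow> bool" where
  "regular_cone C \<longleftrightarrow> cone C \<and> C \<inter> uminus ` C = {0} \<and> closed C \<and> convex C
     \<and> interior C \<noteq> {}"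

definition ray :: "'a::real_vector \<Rightarrow> 'a set" where
  "ray x = {t *\<^sub>R x | t. t \<ge> (0::real)}"

definition extreme_ray :: "'a::real_vector set \<Rightarrow> 'a set \<Rightarrow> bool" where
  "extreme_ray C R \<longleftrightarrow> (\<exists>x. x \<noteq> 0 \<and> R = ray x \<and> R face_of C)"

definition smooth_cone :: "'a::euclidean_space set \<Rightarrow> bool" where
  "smooth_cone C \<longleftrightarrow> regular_cone C
     \<and> (\<forall>z\<in>frontier C. \<exists>R. extreme_ray C R \<and> z \<in> R)
     \<and> (\<forall>R. extreme_ray C R \<longrightarrow> (\<forall>x\<in>R. x \<noteq> 0 \<longrightarrow> dim (normal_cone C x) = 1))"

definition local_error_bound ::
  "('a::real_normed_vector \<Rightarrow> 'b::real_normed_vector) \<Rightarrow> 'b set \<Rightarrow> 'a \<Rightarrow> bool" where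
  "local_error_bound h K xbar \<longleftrightarrow>
     (\<exists>U \<alpha>. open U \<and> xbar \<in> U \<and> \<alpha> > 0 \<and>
        (\<forall>x\<in>U. infdist x {y. h y \<in> K} \<le> \<alpha> * infdist (h x) K))"

end

theory Submission
  imports Defs
begin

text \<open>
  If the error bound holds near \<open>x \<in> S\<close> with constant \<open>\<alpha>\<close> and \<open>v \<in> N\<^sub>S(x)\<close>, then differentiating
  along rays gives \<open>\<langle>v, u\<rangle> \<le> \<alpha> \<parallel>v\<parallel> d(h'(x)u, T)\<close> for every direction \<open>u\<close>, where \<open>T\<close> is the tangent
  cone of \<open>K\<close> at \<open>h(x)\<close>. The distance of \<open>w\<close> to \<open>T\<close> equals \<open>\<langle>n, w\<rangle>\<close> for some \<open>n\<close> in the unit ball of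
  the polar cone \<open>N\<^sub>K(h(x))\<close> of \<open>T\<close>. Hence no hyperplane separates \<open>v\<close> from the compact convex
  image under \<open>h'(x)\<^sup>*\<close> of the ball of radius \<open>\<alpha> \<parallel>v\<parallel>\<close> in \<open>N\<^sub>K(h(x))\<close>.

  Conversely, projecting onto \<open>S\<close> and using concavity, the error bound holds as soon as there is
  \<open>c > 0\<close> such that every unit \<open>v \<in> N\<^sub>S(s)\<close> with \<open>s\<close> near \<open>xbar\<close> has \<open>\<langle>n, h'(s)v\<rangle> \<ge> c\<close> for some
  \<open>n\<close> in the unit ball of \<open>N\<^sub>K(h(s))\<close>. If \<open>h'(xbar)\<^sup>*\<close> vanishes at no non-zero \<open>n \<in> N\<^sub>K(h(xbar))\<close>,
  compactness bounds the multipliers \<open>m\<close> in \<open>v = h'(s)\<^sup>* m\<close> provided by ACQ, and \<open>n = m / \<parallel>m\<parallel>\<close>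
  will do. If \<open>h'(xbar)\<^sup>* n\<^sub>0 = 0\<close> with \<open>n\<^sub>0 \<noteq> 0\<close>, the convex function \<open>\<langle>n\<^sub>0, h\<rangle>\<close> is minimal on all
  of \<open>S\<close>, so that \<open>n\<^sub>0 \<in> N\<^sub>K(h(s))\<close> and \<open>h'(s)\<^sup>* n\<^sub>0 = 0\<close> for all \<open>s \<in> S\<close>. Where \<open>h(s) \<noteq> 0\<close>,
  smoothness makes \<open>N\<^sub>K(h(s))\<close> the ray of \<open>n\<^sub>0\<close>, and ACQ leaves no unit \<open>v\<close>. If \<open>h(s) = 0\<close> for
  \<open>s\<close> arbitrarily close to \<open>xbar\<close>, then \<open>h(xbar) = 0\<close> as well, so \<open>N\<^sub>K(h(s)) = N\<^sub>K(h(xbar))\<close>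
  for these \<open>s\<close>, and a multiplier for a limiting normal at \<open>xbar\<close> serves all normals nearby.
\<close>

subsection \<open>Normal cones\<close>

lemma inner_sgn_self: "v \<bullet> sgn v = norm v"
  by (cases "v = 0") (simp_all add: sgn_div_norm dot_square_norm power2_eq_square)

lemma normal_cone_scaleR:
  assumes "n \<in> normal_cone D x" "c \<ge> 0"
  shows "c *\<^sub>R n \<in> normal_cone D x"
  using assms by (simp add: normal_cone_def mult_nonneg_nonpos)

lemma normal_cone_sgn:
  assumes "n \<in> normal_cone D x"
  shows "sgn n \<in> normal_cone D x"
  unfolding sgn_div_norm using assms by (intro normal_cone_scaleR) auto

lemma convex_normal_cone: "convex (normal_cone D x)"
  unfolding convex_def normal_cone_def
  by (auto simp: inner_left_distrib intro!: add_nonpos_nonpos mult_nonneg_nonpos)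

lemma closed_normal_cone: "closed (normal_cone D x)"
proof -
  have "normal_cone D x = (\<Inter>y\<in>D. {v. (y - x) \<bullet> v \<le> 0})"
    by (auto simp: normal_cone_def inner_commute)
  then show ?thesis
    by (simp add: closed_INT closed_halfspace_le)
qed

lemma normal_cone_interior:
  assumes "x \<in> interior D"
  shows "normal_cone D x \<subseteq> {0}"
proof
  fix v assume v: "v \<in> normal_cone D x"
  obtain e where e: "e > 0" "cball x e \<subseteq> D"
    using assms mem_interior_cball by blast
  have "x + e *\<^sub>R sgn v \<in> D"
    using e by (intro subsetD[OF e(2)]) (auto simp: dist_norm norm_sgn)
  then have "v \<bullet> ((x + e *\<^sub>R sgn v) - x) \<le> 0"
    using v unfolding normal_cone_def by blast
  then have "e * norm v \<le> 0"
    by (simp add: inner_sgn_self)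
  with e(1) show "v \<in> {0}"
    by (simp add: mult_le_0_iff)
qed

lemma normal_cone_closest_point:
  fixes D :: "'a::euclidean_space set"
  assumes "closed D" "convex D"
  shows "x - closest_point D x \<in> normal_cone D (closest_point D x)"
  unfolding normal_cone_def using closest_point_dot[OF assms(2,1)] by blast

lemma normal_cone_inner_le_infdist:
  assumes v: "v \<in> normal_cone D x" and "D \<noteq> {}"
  shows "v \<bullet> (z - x) \<le> norm v * infdist z D"
proof (cases "v = 0")
  case False
  have "v \<bullet> (z - x) / norm v \<le> dist z y" if "y \<in> D" for y
  proof -
    have "v \<bullet> (z - x) = v \<bullet> (z - y) + v \<bullet> (y - x)"
      by (simp add: inner_diff_right)
    also have "\<dots> \<le> norm v * dist z y"
      using v that norm_cauchy_schwarz[of v "z - y"] by (fastforce simp: normal_cone_def dist_norm)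
    finally show ?thesis
      using False by (simp add: field_simps)
  qed
  then have "v \<bullet> (z - x) / norm v \<le> infdist z D"
    unfolding infdist_notempty[OF \<open>D \<noteq> {}\<close>] using \<open>D \<noteq> {}\<close> by (intro cINF_greatest) auto
  then show ?thesis
    using False by (simp add: field_simps)
qed simp

lemma normal_cone_cone:
  assumes "cone K" "w \<in> K"
  shows "normal_cone K w = {n \<in> normal_cone K 0. n \<bullet> w = 0}"
proof (intro equalityI subsetI)
  fix n assume n: "n \<in> normal_cone K w"
  have "0 \<in> K" "2 *\<^sub>R w \<in> K"
    using assms cone_contains_0 mem_cone by (blast, simp add: mem_cone)
  with n have "n \<bullet> (0 - w) \<le> 0" "n \<bullet> (2 *\<^sub>R w - w) \<le> 0"
    unfolding normal_cone_def by blast+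
  then have "n \<bullet> w = 0"
    by (simp add: inner_diff_right)
  with n show "n \<in> {n \<in> normal_cone K 0. n \<bullet> w = 0}"
    by (simp add: normal_cone_def inner_diff_right)
qed (simp add: normal_cone_def inner_diff_right)

lemma infdist_cone_eq_inner_normal:
  fixes K :: "'a::euclidean_space set"
  assumes "cone K" "closed K" "convex K" "K \<noteq> {}"
  obtains n where "n \<in> normal_cone K 0" "norm n \<le> 1" "infdist w K = n \<bullet> w"
proof
  define p where "p = closest_point K w"
  define n where "n = sgn (w - p)"
  have "p \<in> K"
    unfolding p_def using assms closest_point_in_set by blast
  moreover have "n \<in> normal_cone K p"
    unfolding n_def p_def by (intro normal_cone_sgn normal_cone_closest_point assms)
  ultimately have n: "n \<in> normal_cone K 0" "n \<bullet> p = 0"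
    using normal_cone_cone[OF assms(1)] by auto
  show "n \<in> normal_cone K 0"
    by (fact n)
  show "norm n \<le> 1"
    by (simp add: n_def norm_sgn)
  have "infdist w K = norm (w - p)"
    unfolding p_def using assms
    by (simp add: infdist_eq_setdist setdist_closest_point dist_norm)
  also have "\<dots> = n \<bullet> (w - p)"
    unfolding n_def by (metis inner_sgn_self inner_commute)
  finally show "infdist w K = n \<bullet> w"
    using n by (simp add: inner_diff_right)
qed

lemma smooth_coneD:
  assumes "smooth_cone K"
  shows "cone K" "closed K" "convex K"
  using assms unfolding smooth_cone_def regular_cone_def by auto

lemma smooth_cone_normal_cone_subset_span:
  assumes "smooth_cone K" "w \<in> K" "w \<noteq> 0" "n \<in> normal_cone K w" "n \<noteq> 0"
  shows "normal_cone K w \<subseteq> span {n}"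
proof -
  have "w \<notin> interior K"
    using normal_cone_interior assms(4,5) by blast
  then have "w \<in> frontier K"
    using assms(2) smooth_coneD(2)[OF assms(1)] by (simp add: frontier_def)
  then have "dim (normal_cone K w) = 1"
    using assms(1,3) unfolding smooth_cone_def by blast
  moreover have "{n} \<subseteq> span (normal_cone K w)" "independent {n}"
    using assms(4,5) by (auto simp: span_base)
  ultimately have "span (normal_cone K w) \<subseteq> span {n}"
    using card_ge_dim_independent[of "{n}" "span (normal_cone K w)"] by simp
  then show ?thesis
    using span_superset by blast
qed

subsection \<open>Concave maps into a cone\<close>

lemma K_concave_imp_convex_on_inner:
  assumes "K_concave K h" "n \<in> normal_cone K 0"
  shows "convex_on UNIV (\<lambda>x. n \<bullet> h x)"
proof
  fix t :: real and x y assume "0 < t" "t < 1"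
  then have "n \<bullet> (h ((1 - t) *\<^sub>R x + t *\<^sub>R y) - ((1 - t) *\<^sub>R h x + t *\<^sub>R h y)) \<le> 0"
    using assms unfolding K_concave_def normal_cone_def by force
  then show "n \<bullet> h ((1 - t) *\<^sub>R x + t *\<^sub>R y) \<le> (1 - t) * (n \<bullet> h x) + t * (n \<bullet> h y)"
    by (simp add: inner_diff_right inner_add_right)
qed simp

lemma convex_on_imp_above_derivative:
  fixes f :: "'a::real_normed_vector \<Rightarrow> real"
  assumes "convex_on UNIV f" and der: "(f has_derivative f') (at x)"
  shows "f' (y - x) \<le> f y - f x"
proof -
  define g where "g t = f (x + t *\<^sub>R (y - x))" for t
  have line: "x + ((1 - t) * a + t * b) *\<^sub>R (y - x)
      = (1 - t) *\<^sub>R (x + a *\<^sub>R (y - x)) + t *\<^sub>R (x + b *\<^sub>R (y - x))" for t a b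
    by (simp add: algebra_simps)
  have "convex_on UNIV g"
    by (rule convex_onI) (auto simp: g_def line intro!: convex_onD[OF assms(1)])
  moreover have "(g has_real_derivative f' (y - x)) (at 0)"
  proof -
    have "((\<lambda>t. x + t *\<^sub>R (y - x)) has_derivative (\<lambda>t. t *\<^sub>R (y - x))) (at 0)"
      by (auto intro!: derivative_eq_intros)
    then have "(g has_derivative (\<lambda>t. f' (t *\<^sub>R (y - x)))) (at 0)"
      unfolding g_def by (rule has_derivative_compose) (simp add: der)
    then show ?thesis
      by (simp add: has_field_derivative_def mult_commute_abs
          linear_scale[OF has_derivative_linear[OF der]])
  qed
  ultimately have "f' (y - x) * (1 - 0) \<le> g 1 - g 0"
    by (intro convex_on_imp_above_tangent[of UNIV g]) auto
  then show ?thesis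
    by (simp add: g_def)
qed

lemma K_concave_inner_derivative_le:
  assumes "K_concave K h" "n \<in> normal_cone K 0" "(h has_derivative A) (at x)"
  shows "n \<bullet> A (y - x) \<le> n \<bullet> (h y - h x)"
  using convex_on_imp_above_derivative[OF K_concave_imp_convex_on_inner[OF assms(1,2)]
      has_derivative_inner_right[OF assms(3)], of y]
  by (simp add: inner_diff_right)

lemma convex_K_concave_vimage:
  assumes "K_concave K h" "cone K" "convex K"
  shows "convex (h -` K)"
  unfolding convex_alt
proof (intro ballI allI impI)
  fix x y and t :: real
  assume xy: "x \<in> h -` K" "y \<in> h -` K" and t: "0 \<le> t \<and> t \<le> 1"
  have "h ((1 - t) *\<^sub>R x + t *\<^sub>R y) - ((1 - t) *\<^sub>R h x + t *\<^sub>R h y) \<in> K"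
    using assms(1) t unfolding K_concave_def by auto
  moreover have "(1 - t) *\<^sub>R h x + t *\<^sub>R h y \<in> K"
    using assms(3) xy t unfolding convex_alt by blast
  ultimately have "(h ((1 - t) *\<^sub>R x + t *\<^sub>R y) - ((1 - t) *\<^sub>R h x + t *\<^sub>R h y))
      + ((1 - t) *\<^sub>R h x + t *\<^sub>R h y) \<in> K"
    using assms(2,3) convex_cone by blast
  then show "(1 - t) *\<^sub>R x + t *\<^sub>R y \<in> h -` K"
    by simp
qed

lemma adjoint_image_normal_cone_subset:
  fixes h :: "'a::euclidean_space \<Rightarrow> 'b::euclidean_space"
  assumes "K_concave K h" "cone K" "(h has_derivative A) (at x)" "h x \<in> K"
  shows "adjoint A ` normal_cone K (h x) \<subseteq> normal_cone (h -` K) x"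
proof (intro image_subsetI)
  fix n assume n: "n \<in> normal_cone K (h x)"
  then have "n \<in> normal_cone K 0"
    using normal_cone_cone assms(2,4) by blast
  then have "n \<bullet> A (y - x) \<le> n \<bullet> (h y - h x)" for y
    by (rule K_concave_inner_derivative_le[OF assms(1) _ assms(3)])
  moreover have "n \<bullet> (h y - h x) \<le> 0" if "y \<in> h -` K" for y
    using n that by (simp add: normal_cone_def)
  ultimately show "adjoint A n \<in> normal_cone (h -` K) x"
    by (force simp: normal_cone_def adjoint_clauses has_derivative_linear[OF assms(3)]
        intro: order_trans)
qed

definition abadie_cq ::
  "('a::real_inner \<Rightarrow> 'b::real_inner) \<Rightarrow> 'b set \<Rightarrow> ('a \<Rightarrow> 'b) \<Rightarrow> 'a \<Rightarrow> bool" where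
  "abadie_cq h K A x \<longleftrightarrow> adjoint A ` normal_cone K (h x) = normal_cone (h -` K) x"

subsection \<open>The error bound implies the constraint qualification\<close>

text \<open>For convex \<open>D\<close> and \<open>x \<in> D\<close> this is the usual (Bouligand) tangent cone.\<close>

definition tangent_cone :: "'a::real_normed_vector set \<Rightarrow> 'a \<Rightarrow> 'a set" where
  "tangent_cone D x = closure (cone hull ((\<lambda>y. y - x) ` D))"

lemma cone_tangent_cone: "cone (tangent_cone D x)"
  unfolding tangent_cone_def by (intro cone_closure cone_cone_hull)

lemma closed_tangent_cone: "closed (tangent_cone D x)"
  by (simp add: tangent_cone_def)

lemma convex_tangent_cone:
  assumes "convex D"
  shows "convex (tangent_cone D x)"
  unfolding tangent_cone_def using assms
  by (intro convex_closure convex_cone_hull convex_translation_subtract)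

lemma normal_cone_tangent_cone: "normal_cone (tangent_cone D x) 0 = normal_cone D x"
proof (intro equalityI subsetI)
  fix v assume "v \<in> normal_cone (tangent_cone D x) 0"
  moreover have "y - x \<in> tangent_cone D x" if "y \<in> D" for y
    unfolding tangent_cone_def using that by (intro closure_subset[THEN subsetD] hull_inc) auto
  ultimately show "v \<in> normal_cone D x"
    by (auto simp: normal_cone_def)
next
  fix v assume "v \<in> normal_cone D x"
  then have "cone hull ((\<lambda>y. y - x) ` D) \<subseteq> {w. v \<bullet> w \<le> 0}"
    by (auto simp: cone_hull_expl normal_cone_def mult_nonneg_nonpos)
  then have "tangent_cone D x \<subseteq> {w. v \<bullet> w \<le> 0}"
    unfolding tangent_cone_def by (intro closure_minimal closed_halfspace_le)
  then show "v \<in> normal_cone (tangent_cone D x) 0"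
    by (auto simp: normal_cone_def)
qed

lemma tangent_cone_approximation:
  fixes C :: "'a::real_normed_vector set"
  assumes C: "convex C" "x \<in> C" and d: "infdist u (tangent_cone C x) < d"
  obtains w where "dist u w < d" "\<forall>\<^sub>F t in at_right 0. x + t *\<^sub>R w \<in> C"
proof -
  define T where "T = cone hull ((\<lambda>y. y - x) ` C)"
  have "T \<noteq> {}"
    using C(2) by (auto simp: T_def simp flip: cone_hull_empty_iff)
  moreover have "infdist u T < d"
    using d by (simp add: tangent_cone_def T_def infdist_eq_setdist)
  ultimately obtain w where w: "w \<in> T" "dist u w < d"
    by (auto simp: infdist_notempty cINF_less_iff)
  then obtain a y where y: "w = a *\<^sub>R (y - x)" "a \<ge> 0" "y \<in> C"
    unfolding T_def cone_hull_expl by blast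
  have "((\<lambda>t. t * a) \<longlongrightarrow> 0 * a) (at_right 0)"
    by (intro tendsto_intros)
  then have "\<forall>\<^sub>F t in at_right 0. t * a < 1"
    by (rule order_tendstoD) simp
  with eventually_at_right_less have "\<forall>\<^sub>F t in at_right 0. x + t *\<^sub>R w \<in> C"
  proof eventually_elim
    case (elim t)
    then have "(1 - t * a) *\<^sub>R x + (t * a) *\<^sub>R y \<in> C"
      using C y by (intro convexD_alt) auto
    then show ?case
      by (simp add: y(1) algebra_simps)
  qed
  with w(2) show thesis
    by (rule that)
qed

lemma eventually_infdist_le_tangent_cone:
  fixes h :: "'a::real_normed_vector \<Rightarrow> 'b::real_normed_vector"
  assumes C: "convex C" "h x \<in> C" and der: "(h has_derivative A) (at x)"
    and d: "infdist (A u) (tangent_cone C (h x)) < d"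
  shows "\<forall>\<^sub>F t in at_right 0. infdist (h (x + t *\<^sub>R u)) C \<le> t * d"
proof -
  obtain w where w: "dist (A u) w < d" "\<forall>\<^sub>F t in at_right 0. h x + t *\<^sub>R w \<in> C"
    using tangent_cone_approximation[OF C d] .
  have "((\<lambda>t. x + t *\<^sub>R u) has_derivative (\<lambda>t. t *\<^sub>R u)) (at_right 0)"
    by (auto intro!: derivative_eq_intros)
  then have "((\<lambda>t. h (x + t *\<^sub>R u)) has_derivative (\<lambda>t. A (t *\<^sub>R u))) (at_right 0)"
    by (rule has_derivative_compose) (simp add: der)
  then have "\<forall>\<^sub>F t in at_right 0.
      norm (h (x + t *\<^sub>R u) - h x - t *\<^sub>R A u) \<le> (d - dist (A u) w) * norm t"
    using w(1) linear_scale[OF has_derivative_linear[OF der]]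
    unfolding has_derivative_within_alt2 by simp
  with w(2) eventually_at_right_less show ?thesis
  proof eventually_elim
    case (elim t)
    have "infdist (h (x + t *\<^sub>R u)) C \<le> norm (h (x + t *\<^sub>R u) - (h x + t *\<^sub>R w))"
      using infdist_le[OF elim(1)] by (simp add: dist_norm)
    also have "\<dots> = norm ((h (x + t *\<^sub>R u) - h x - t *\<^sub>R A u) + t *\<^sub>R (A u - w))"
      by (simp add: algebra_simps)
    also have "\<dots> \<le> (d - dist (A u) w) * t + t * dist (A u) w"
      using elim(2,3) by (intro norm_triangle_mono) (auto simp: dist_norm)
    finally show ?case
      by (simp add: algebra_simps)
  qed
qed

lemma error_bound_imp_normal_inner_le:
  fixes h :: "'a::real_inner \<Rightarrow> 'b::real_normed_vector"
  assumes C: "convex C" "h x \<in> C" and der: "(h has_derivative A) (at x)"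
    and bound: "\<forall>\<^sub>F z in nhds x. infdist z (h -` C) \<le> \<alpha> * infdist (h z) C" and "\<alpha> \<ge> 0"
    and v: "v \<in> normal_cone (h -` C) x"
  shows "v \<bullet> u \<le> \<alpha> * norm v * infdist (A u) (tangent_cone C (h x))"
proof (rule tendsto_lowerbound)
  let ?r = "infdist (A u) (tangent_cone C (h x))"
  show "((\<lambda>d. \<alpha> * norm v * d) \<longlongrightarrow> \<alpha> * norm v * ?r) (at_right ?r)"
    by (intro tendsto_intros)
  have "v \<bullet> u \<le> \<alpha> * norm v * d" if "?r < d" for d
  proof -
    have "((\<lambda>t. x + t *\<^sub>R u) \<longlongrightarrow> x + 0 *\<^sub>R u) (at_right 0)"
      by (intro tendsto_intros)
    then have "\<forall>\<^sub>F t in at_right 0.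
        infdist (x + t *\<^sub>R u) (h -` C) \<le> \<alpha> * infdist (h (x + t *\<^sub>R u)) C"
      using bound by (auto simp: filterlim_iff)
    with eventually_infdist_le_tangent_cone[OF C der that] eventually_at_right_less
    have "\<forall>\<^sub>F t in at_right 0. 0 < t \<and> infdist (h (x + t *\<^sub>R u)) C \<le> t * d \<and>
        infdist (x + t *\<^sub>R u) (h -` C) \<le> \<alpha> * infdist (h (x + t *\<^sub>R u)) C"
      by eventually_elim blast
    then obtain t where t: "0 < t" "infdist (h (x + t *\<^sub>R u)) C \<le> t * d"
        "infdist (x + t *\<^sub>R u) (h -` C) \<le> \<alpha> * infdist (h (x + t *\<^sub>R u)) C"
      using eventually_happens' trivial_limit_at_right_real by blast
    have "t * (v \<bullet> u) = v \<bullet> ((x + t *\<^sub>R u) - x)"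
      by simp
    also have "\<dots> \<le> norm v * infdist (x + t *\<^sub>R u) (h -` C)"
      using C(2) by (intro normal_cone_inner_le_infdist[OF v]) auto
    also have "\<dots> \<le> norm v * (\<alpha> * (t * d))"
      using t(2) \<open>\<alpha> \<ge> 0\<close> by (intro mult_left_mono order_trans[OF t(3)]) auto
    finally have "t * (v \<bullet> u) \<le> t * (\<alpha> * norm v * d)"
      by (simp add: mult_ac)
    with t(1) show ?thesis
      by simp
  qed
  then show "\<forall>\<^sub>F d in at_right ?r. v \<bullet> u \<le> \<alpha> * norm v * d"
    using eventually_at_right_less by (rule eventually_mono[rotated])
qed simp

lemma error_bound_imp_dominating_normal:
  fixes h :: "'a::real_inner \<Rightarrow> 'b::euclidean_space"
  assumes C: "convex C" "h x \<in> C" and der: "(h has_derivative A) (at x)"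
    and bound: "\<forall>\<^sub>F z in nhds x. infdist z (h -` C) \<le> \<alpha> * infdist (h z) C" and "\<alpha> \<ge> 0"
    and v: "v \<in> normal_cone (h -` C) x"
  obtains m where "m \<in> normal_cone C (h x)" "norm m \<le> \<alpha> * norm v" "v \<bullet> u \<le> m \<bullet> A u"
proof -
  have "tangent_cone C (h x) \<noteq> {}"
    using C(2) by (auto simp: tangent_cone_def simp flip: cone_hull_empty_iff)
  then obtain n where n: "n \<in> normal_cone (tangent_cone C (h x)) 0" "norm n \<le> 1"
      "infdist (A u) (tangent_cone C (h x)) = n \<bullet> A u"
    using infdist_cone_eq_inner_normal[OF cone_tangent_cone closed_tangent_cone
        convex_tangent_cone[OF C(1)]] by blast
  show thesis
  proof
    show "(\<alpha> * norm v) *\<^sub>R n \<in> normal_cone C (h x)"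
      using n(1) \<open>\<alpha> \<ge> 0\<close> by (simp add: normal_cone_tangent_cone normal_cone_scaleR)
    show "norm ((\<alpha> * norm v) *\<^sub>R n) \<le> \<alpha> * norm v"
      using n(2) \<open>\<alpha> \<ge> 0\<close> by (simp add: abs_mult mult_left_le)
    show "v \<bullet> u \<le> (\<alpha> * norm v) *\<^sub>R n \<bullet> A u"
      using error_bound_imp_normal_inner_le[OF assms, of u] n(3) by simp
  qed
qed

lemma mem_closed_convex_if_dominated:
  fixes v :: "'a::euclidean_space"
  assumes "closed Q" "convex Q" "\<And>u. \<exists>q\<in>Q. v \<bullet> u \<le> q \<bullet> u"
  shows "v \<in> Q"
proof (rule ccontr)
  assume "v \<notin> Q"
  then obtain a b where ab: "a \<bullet> v < b" "\<forall>q\<in>Q. b < a \<bullet> q"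
    using separating_hyperplane_closed_point assms by blast
  obtain q where "q \<in> Q" "v \<bullet> (- a) \<le> q \<bullet> (- a)"
    using assms(3) by blast
  with ab show False
    by (force simp: inner_commute)
qed

lemma error_bound_imp_normal_cone_subset:
  fixes h :: "'a::euclidean_space \<Rightarrow> 'b::euclidean_space"
  assumes "convex C" "h x \<in> C" and der: "(h has_derivative A) (at x)"
    and "\<forall>\<^sub>F z in nhds x. infdist z (h -` C) \<le> \<alpha> * infdist (h z) C" "\<alpha> \<ge> 0"
  shows "normal_cone (h -` C) x \<subseteq> adjoint A ` normal_cone C (h x)"
proof
  fix v assume v: "v \<in> normal_cone (h -` C) x"
  define B where "B = normal_cone C (h x) \<inter> cball 0 (\<alpha> * norm v)"
  have A: "linear A"
    using der by (rule has_derivative_linear)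
  then have A': "linear (adjoint A)"
    by (rule adjoint_linear)
  have "v \<in> adjoint A ` B"
  proof (rule mem_closed_convex_if_dominated)
    have "compact B"
      unfolding B_def by (simp add: closed_Int_compact closed_normal_cone)
    then show "closed (adjoint A ` B)"
      using A' by (intro compact_imp_closed compact_continuous_image linear_continuous_on)
        (auto simp: linear_conv_bounded_linear)
    show "convex (adjoint A ` B)"
      unfolding B_def by (intro convex_linear_image A' convex_Int convex_normal_cone convex_cball)
    show "\<exists>q\<in>adjoint A ` B. v \<bullet> u \<le> q \<bullet> u" for u
    proof -
      obtain m where "m \<in> normal_cone C (h x)" "norm m \<le> \<alpha> * norm v" "v \<bullet> u \<le> m \<bullet> A u"
        using error_bound_imp_dominating_normal[OF assms v] .
      then show ?thesis
        by (intro bexI[of _ "adjoint A m"]) (auto simp: B_def adjoint_clauses A)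
    qed
  qed
  then show "v \<in> adjoint A ` normal_cone C (h x)"
    unfolding B_def by blast
qed

lemma local_error_bound_iff_eventually:
  "local_error_bound h K x \<longleftrightarrow>
     (\<exists>\<alpha>>0. \<forall>\<^sub>F z in nhds x. infdist z (h -` K) \<le> \<alpha> * infdist (h z) K)"
  unfolding local_error_bound_def eventually_nhds vimage_def by blast

lemma local_error_bound_imp_abadie_cq:
  fixes h :: "'a::euclidean_space \<Rightarrow> 'b::euclidean_space"
  assumes conc: "K_concave K h" and K: "cone K" "convex K"
    and der: "\<And>x. (h has_derivative A x) (at x)" and bound: "local_error_bound h K x"
  shows "\<forall>\<^sub>F s in nhds x. h s \<in> K \<longrightarrow> abadie_cq h K (A s) s"
proof -
  obtain \<alpha> where "\<alpha> > 0"
      "\<forall>\<^sub>F s in nhds x. \<forall>\<^sub>F z in nhds s. infdist z (h -` K) \<le> \<alpha> * infdist (h z) K"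
    using bound unfolding local_error_bound_iff_eventually eventually_eventually by blast
  from this(2) show ?thesis
  proof eventually_elim
    case (elim s)
    have "abadie_cq h K (A s) s" if "h s \<in> K"
      unfolding abadie_cq_def
    proof
      show "adjoint (A s) ` normal_cone K (h s) \<subseteq> normal_cone (h -` K) s"
        using conc K(1) der that by (rule adjoint_image_normal_cone_subset)
      show "normal_cone (h -` K) s \<subseteq> adjoint (A s) ` normal_cone K (h s)"
        using error_bound_imp_normal_cone_subset[OF K(2) that der elim] \<open>\<alpha> > 0\<close> by simp
    qed
    then show ?case
      by blast
  qed
qed

subsection \<open>Slopes along unit normals\<close>

definition normal_slope_ge ::
  "real \<Rightarrow> ('a::real_inner \<Rightarrow> 'b::real_inner) \<Rightarrow> 'b set \<Rightarrow> ('a \<Rightarrow> 'b) \<Rightarrow> 'a \<Rightarrow> bool" where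
  "normal_slope_ge c h K A x \<longleftrightarrow>
     (\<forall>v\<in>normal_cone (h -` K) x. norm v = 1 \<longrightarrow> (\<exists>n\<in>normal_cone K (h x). norm n \<le> 1 \<and> c \<le> n \<bullet> A v))"

lemma normal_slope_ge_imp_infdist_le:
  fixes h :: "'a::euclidean_space \<Rightarrow> 'b::real_inner"
  assumes conc: "K_concave K h" and "cone K"
    and S: "closed (h -` K)" "convex (h -` K)" "h -` K \<noteq> {}"
    and s: "s = closest_point (h -` K) x"
    and der: "(h has_derivative A) (at s)" and slope: "normal_slope_ge c h K A s"
  shows "c * infdist x (h -` K) \<le> infdist (h x) K"
proof (cases "x = s")
  case True
  moreover have "s \<in> h -` K"
    unfolding s using S closest_point_in_set by blast
  ultimately show ?thesis
    by (simp add: infdist_nonneg)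
next
  case False
  have hs: "h s \<in> K"
    using closest_point_in_set[OF S(1,3), of x] by (simp add: s)
  have "sgn (x - s) \<in> normal_cone (h -` K) s"
    unfolding s by (intro normal_cone_sgn normal_cone_closest_point S)
  then obtain n where n: "n \<in> normal_cone K (h s)" "norm n \<le> 1" "c \<le> n \<bullet> A (sgn (x - s))"
    using slope False unfolding normal_slope_ge_def by (auto simp: norm_sgn)
  have "infdist x (h -` K) = norm (x - s)"
    unfolding s using S by (simp add: infdist_eq_setdist setdist_closest_point dist_norm)
  then have "c * infdist x (h -` K) \<le> (n \<bullet> A (sgn (x - s))) * norm (x - s)"
    using n(3) by (simp add: mult_right_mono)
  also have "\<dots> = n \<bullet> A (x - s)"
    using False by (simp add: sgn_div_norm linear_scale[OF has_derivative_linear[OF der]])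
  also have "\<dots> \<le> n \<bullet> (h x - h s)"
    using n(1) normal_cone_cone[OF \<open>cone K\<close> hs]
    by (intro K_concave_inner_derivative_le[OF conc _ der]) auto
  also have "\<dots> \<le> norm n * infdist (h x) K"
    using hs by (intro normal_cone_inner_le_infdist[OF n(1)]) auto
  also have "\<dots> \<le> infdist (h x) K"
    using n(2) by (simp add: mult_left_le_one_le infdist_nonneg)
  finally show ?thesis .
qed

lemma normal_slope_ge_imp_local_error_bound:
  fixes h :: "'a::euclidean_space \<Rightarrow> 'b::euclidean_space"
  assumes conc: "K_concave K h" and K: "cone K" "closed K" "convex K"
    and der: "\<And>x. (h has_derivative A x) (at x)"
    and x: "h x \<in> K" and "c > 0"
    and slope: "\<forall>\<^sub>F s in nhds x. h s \<in> K \<longrightarrow> normal_slope_ge c h K (A s) s"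
  shows "local_error_bound h K x"
proof -
  let ?S = "h -` K"
  have "isCont h z" for z
    using der by (rule has_derivative_continuous)
  then have S: "closed ?S" "convex ?S" "x \<in> ?S" "?S \<noteq> {}"
    using K x conc by (auto intro!: continuous_closed_vimage convex_K_concave_vimage)
  obtain e where e: "e > 0" "\<And>s. dist s x < e \<Longrightarrow> h s \<in> K \<Longrightarrow> normal_slope_ge c h K (A s) s"
    using slope unfolding eventually_nhds_metric by blast
  have "infdist z ?S \<le> inverse c * infdist (h z) K" if "dist z x < e" for z
  proof -
    let ?s = "closest_point ?S z"
    have "?s \<in> ?S"
      using S closest_point_in_set by blast
    moreover have "dist ?s x < e"
      using closest_point_lipschitz[OF S(2,1,4), of z x] closest_point_self[OF S(3)] that by simp
    ultimately have "c * infdist z ?S \<le> infdist (h z) K"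
      by (intro normal_slope_ge_imp_infdist_le[OF conc K(1) S(1,2,4) refl der] e(2)) auto
    then show ?thesis
      using \<open>c > 0\<close> by (simp add: field_simps)
  qed
  then show ?thesis
    unfolding local_error_bound_iff_eventually eventually_nhds_metric
    using e(1) \<open>c > 0\<close> by (intro exI[of _ "inverse c"]) auto
qed

subsection \<open>The constraint qualification implies the error bound\<close>

lemma eventually_compact_ball:
  assumes "compact T" "\<And>t. t \<in> T \<Longrightarrow> \<forall>\<^sub>F (a, t') in F \<times>\<^sub>F nhds t. P a t'"
  shows "\<forall>\<^sub>F a in F. \<forall>t\<in>T. P a t"
proof -
  have "\<exists>Q U. eventually Q F \<and> open U \<and> t \<in> U \<and> (\<forall>a t'. Q a \<longrightarrow> t' \<in> U \<longrightarrow> P a t')"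
    if "t \<in> T" for t
    using assms(2)[OF that] unfolding eventually_prod_filter eventually_nhds by auto metis
  then obtain Q U where QU: "\<And>t. t \<in> T \<Longrightarrow> eventually (Q t) F" "\<And>t. t \<in> T \<Longrightarrow> open (U t)"
      "\<And>t. t \<in> T \<Longrightarrow> t \<in> U t" "\<And>t a t'. t \<in> T \<Longrightarrow> Q t a \<Longrightarrow> t' \<in> U t \<Longrightarrow> P a t'"
    by metis
  have "T \<subseteq> (\<Union>t\<in>T. U t)"
    using QU(3) by blast
  then obtain T0 where T0: "T0 \<subseteq> T" "finite T0" "T \<subseteq> (\<Union>t\<in>T0. U t)"
    using compactE_image[of T T U] assms(1) QU(2) by blast
  then have "\<forall>\<^sub>F a in F. \<forall>t\<in>T0. Q t a"
    using QU(1) by (intro eventually_ball_finite) auto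
  then show ?thesis
    by eventually_elim (use T0 QU(4) in blast)
qed

lemma eventually_unit_normals:
  fixes D :: "'a::euclidean_space set"
  assumes "(p \<longlongrightarrow> q) F"
    and "\<And>n. n \<in> normal_cone D q \<Longrightarrow> norm n = 1 \<Longrightarrow> \<forall>\<^sub>F (a, m) in F \<times>\<^sub>F nhds n. P a m"
  shows "\<forall>\<^sub>F a in F. \<forall>m\<in>normal_cone D (p a). norm m = 1 \<longrightarrow> P a m"
proof -
  have "\<forall>\<^sub>F (a, m) in F \<times>\<^sub>F nhds n. m \<in> normal_cone D (p a) \<longrightarrow> P a m" if "n \<in> sphere 0 1" for n
  proof (cases "n \<in> normal_cone D q")
    case True
    then have "\<forall>\<^sub>F (a, m) in F \<times>\<^sub>F nhds n. P a m"
      using assms(2) that by simp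
    then show ?thesis
      by (rule eventually_mono) auto
  next
    case False
    then obtain y where y: "y \<in> D" "0 < n \<bullet> (y - q)"
      unfolding normal_cone_def by force
    have "((\<lambda>(a, m). m \<bullet> (y - p a)) \<longlongrightarrow> n \<bullet> (y - q)) (F \<times>\<^sub>F nhds n)"
      unfolding case_prod_unfold
      by (intro tendsto_intros filterlim_snd filterlim_compose[OF assms(1) filterlim_fst])
    from order_tendstoD(1)[OF this y(2)]
    have "\<forall>\<^sub>F (a, m) in F \<times>\<^sub>F nhds n. 0 < m \<bullet> (y - p a)"
      by (simp add: case_prod_unfold)
    then show ?thesis
      by eventually_elim (use y(1) in \<open>auto simp: normal_cone_def not_le\<close>)
  qed
  then have "\<forall>\<^sub>F a in F. \<forall>m\<in>sphere 0 1. m \<in> normal_cone D (p a) \<longrightarrow> P a m"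
    by (intro eventually_compact_ball compact_sphere)
  then show ?thesis
    by (auto elim: eventually_mono)
qed

lemma inner_adjoint_blinfun:
  fixes A :: "'a::euclidean_space \<Rightarrow>\<^sub>L 'b::euclidean_space"
  shows "adjoint A n \<bullet> u = n \<bullet> A u"
  by (simp add: adjoint_clauses blinfun.bounded_linear_right bounded_linear.linear)

lemma linear_adjoint_blinfun:
  fixes A :: "'a::euclidean_space \<Rightarrow>\<^sub>L 'b::euclidean_space"
  shows "linear (adjoint A)"
  by (simp add: adjoint_linear blinfun.bounded_linear_right bounded_linear.linear)

lemma inner_sgn_blinfun_adjoint:
  fixes A :: "'a::euclidean_space \<Rightarrow>\<^sub>L 'b::euclidean_space"
  shows "sgn n \<bullet> A (adjoint A n) = (norm (adjoint A n))\<^sup>2 / norm n"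
proof -
  have "sgn n \<bullet> A (adjoint A n) = (n \<bullet> A (adjoint A n)) / norm n"
    by (simp add: sgn_div_norm divide_inverse_commute)
  then show ?thesis
    by (simp flip: inner_adjoint_blinfun dot_square_norm)
qed

lemma eventually_le_inner_blinfun:
  assumes "filterlim c (at_right 0) F" "(n \<longlongrightarrow> n0) F" "(A \<longlongrightarrow> A0) F" "(u \<longlongrightarrow> u0) F"
    and "0 < n0 \<bullet> blinfun_apply A0 u0"
  shows "\<forall>\<^sub>F z in F. c z \<le> n z \<bullet> blinfun_apply (A z) (u z)"
proof -
  have "(c \<longlongrightarrow> 0) F"
    using assms(1) at_within_le_nhds by (rule filterlim_mono) simp
  then have "((\<lambda>z. n z \<bullet> blinfun_apply (A z) (u z) - c z) \<longlongrightarrow> n0 \<bullet> blinfun_apply A0 u0 - 0) F"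
    by (intro tendsto_intros assms)
  then have "\<forall>\<^sub>F z in F. 0 < n z \<bullet> blinfun_apply (A z) (u z) - c z"
    by (rule order_tendstoD) (use assms(5) in simp)
  then show ?thesis
    by (auto elim: eventually_mono)
qed

lemma eventually_le_norm_adjoint_blinfun:
  fixes A0 :: "'a::euclidean_space \<Rightarrow>\<^sub>L 'b::euclidean_space"
  assumes "filterlim c (at_right 0) F" "(A \<longlongrightarrow> A0) F" "(n \<longlongrightarrow> n0) F"
    and "adjoint A0 n0 \<noteq> 0"
  shows "\<forall>\<^sub>F z in F. c z \<le> norm (adjoint (blinfun_apply (A z)) (n z))"
proof -
  define u where "u = sgn (adjoint A0 n0)"
  have "norm u \<le> 1"
    by (simp add: u_def norm_sgn)
  have "n0 \<bullet> A0 u = norm (adjoint A0 n0)"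
    unfolding inner_adjoint_blinfun[symmetric] u_def by (rule inner_sgn_self)
  then have "\<forall>\<^sub>F z in F. c z \<le> n z \<bullet> blinfun_apply (A z) u"
    using assms by (intro eventually_le_inner_blinfun[OF assms(1,3,2) tendsto_const]) simp
  then show ?thesis
  proof eventually_elim
    case (elim z)
    note elim
    also have "n z \<bullet> blinfun_apply (A z) u \<le> norm (adjoint (blinfun_apply (A z)) (n z)) * norm u"
      unfolding inner_adjoint_blinfun[symmetric] by (rule norm_cauchy_schwarz)
    also have "\<dots> \<le> norm (adjoint (blinfun_apply (A z)) (n z))"
      using \<open>norm u \<le> 1\<close> by (simp add: mult_left_le)
    finally show ?case .
  qed
qed

text \<open>
  Letting a constant \<open>c\<close> tend to 0 from the right alongside the point turns a statement that holds
  eventually, uniformly over a compact set, into one with a single positive constant.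
\<close>

lemma eventually_at_right_prodE:
  assumes "\<forall>\<^sub>F (c, s) in at_right (0::real) \<times>\<^sub>F F. P c s"
  obtains c where "c > 0" "\<forall>\<^sub>F s in F. P c s"
proof -
  obtain Q R where QR: "eventually Q (at_right 0)" "eventually R F" "\<And>c s. Q c \<Longrightarrow> R s \<Longrightarrow> P c s"
    using assms unfolding eventually_prod_filter by auto
  have "\<forall>\<^sub>F c in at_right 0. 0 < c \<and> Q c"
    using eventually_at_right_less QR(1) by (rule eventually_conj)
  then obtain c where "0 < c" "Q c"
    using eventually_happens' trivial_limit_at_right_real by blast
  with QR show thesis
    by (intro that) (auto elim: eventually_mono)
qed

lemma abadie_cq_imp_normal_slope_ge_on_fibre:
  fixes h :: "'a::euclidean_space \<Rightarrow> 'b::euclidean_space" and h' :: "'a \<Rightarrow> 'a \<Rightarrow>\<^sub>L 'b"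
  assumes cont: "isCont h' x"
    and acq: "abadie_cq h K (h' x) x"
  obtains c where "c > 0" "\<forall>\<^sub>F s in nhds x. h s = h x \<longrightarrow> normal_slope_ge c h K (h' s) s"
proof -
  let ?F = "at_right (0::real) \<times>\<^sub>F nhds x"
  let ?P = "\<lambda>(c, s) v. \<exists>n\<in>normal_cone K (h x). norm n \<le> 1 \<and> c \<le> n \<bullet> h' s v"
  have "\<forall>\<^sub>F a in ?F. \<forall>v\<in>normal_cone (h -` K) (snd a). norm v = 1 \<longrightarrow> ?P a v"
  proof (rule eventually_unit_normals)
    show "(snd \<longlongrightarrow> x) ?F"
      by (rule filterlim_snd)
    fix v assume v: "v \<in> normal_cone (h -` K) x" "norm v = 1"
    then obtain q where q: "q \<in> normal_cone K (h x)" "v = adjoint (h' x) q"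
      using acq unfolding abadie_cq_def by blast
    define n where "n = sgn q"
    have n: "n \<in> normal_cone K (h x)" "norm n \<le> 1"
      using q(1) by (auto simp: n_def norm_sgn intro: normal_cone_sgn)
    have "q \<noteq> 0"
      using v(2) q(2) by (auto simp: linear_0 linear_adjoint_blinfun)
    then have "0 < n \<bullet> h' x v"
      using v(2) by (simp add: n_def q(2) inner_sgn_blinfun_adjoint)
    then have "\<forall>\<^sub>F z in ?F \<times>\<^sub>F nhds v. fst (fst z) \<le> n \<bullet> h' (snd (fst z)) (snd z)"
      by (rule eventually_le_inner_blinfun[OF
          filterlim_compose[OF filterlim_fst filterlim_fst] tendsto_const
          isCont_tendsto_compose[OF cont filterlim_compose[OF filterlim_snd filterlim_fst]]
          filterlim_snd])
    then show "\<forall>\<^sub>F (a, v') in ?F \<times>\<^sub>F nhds v. ?P a v'"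
      by eventually_elim (use n in auto)
  qed
  then have "\<forall>\<^sub>F (c, s) in ?F. h s = h x \<longrightarrow> normal_slope_ge c h K (h' s) s"
    by eventually_elim (auto simp: normal_slope_ge_def)
  then show thesis
    by (rule eventually_at_right_prodE) (rule that)
qed

lemma linear_norm_ge_on_normal_cone:
  assumes "linear f" "\<forall>n\<in>normal_cone D x. norm n = 1 \<longrightarrow> c \<le> norm (f n)" "n \<in> normal_cone D x"
  shows "c * norm n \<le> norm (f n)"
proof (cases "n = 0")
  case False
  then have "c \<le> norm (f (sgn n))"
    using assms(2) normal_cone_sgn[OF assms(3)] by (simp add: norm_sgn)
  also have "\<dots> = norm (f n) / norm n"
    by (simp add: sgn_div_norm linear_scale[OF assms(1)] divide_inverse_commute)
  finally show ?thesis
    using False by (simp add: field_simps)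
qed simp

lemma eventually_norm_adjoint_ge:
  fixes h :: "'a::euclidean_space \<Rightarrow> 'b::euclidean_space" and h' :: "'a \<Rightarrow> 'a \<Rightarrow>\<^sub>L 'b"
  assumes cont: "isCont h x" "isCont h' x"
    and regular: "\<And>n. n \<in> normal_cone K (h x) \<Longrightarrow> adjoint (h' x) n = 0 \<Longrightarrow> n = 0"
  obtains c where "c > 0"
    "\<forall>\<^sub>F s in nhds x. \<forall>n\<in>normal_cone K (h s). c * norm n \<le> norm (adjoint (h' s) n)"
proof -
  let ?F = "at_right (0::real) \<times>\<^sub>F nhds x"
  let ?P = "\<lambda>(c, s) n. c \<le> norm (adjoint (h' s) n)"
  have "\<forall>\<^sub>F a in ?F. \<forall>n\<in>normal_cone K (h (snd a)). norm n = 1 \<longrightarrow> ?P a n"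
  proof (rule eventually_unit_normals)
    show "((\<lambda>a. h (snd a)) \<longlongrightarrow> h x) ?F"
      by (rule isCont_tendsto_compose[OF cont(1) filterlim_snd])
    fix n assume "n \<in> normal_cone K (h x)" "norm n = 1"
    then have "adjoint (h' x) n \<noteq> 0"
      using regular by force
    then have "\<forall>\<^sub>F z in ?F \<times>\<^sub>F nhds n. fst (fst z) \<le> norm (adjoint (h' (snd (fst z))) (snd z))"
      by (rule eventually_le_norm_adjoint_blinfun[OF
          filterlim_compose[OF filterlim_fst filterlim_fst]
          isCont_tendsto_compose[OF cont(2) filterlim_compose[OF filterlim_snd filterlim_fst]]
          filterlim_snd])
    then show "\<forall>\<^sub>F (a, m) in ?F \<times>\<^sub>F nhds n. ?P a m"
      by (simp add: case_prod_unfold)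
  qed
  then have "\<forall>\<^sub>F (c, s) in ?F. \<forall>n\<in>normal_cone K (h s). c * norm n \<le> norm (adjoint (h' s) n)"
    by eventually_elim (auto intro: linear_norm_ge_on_normal_cone[OF linear_adjoint_blinfun])
  then show thesis
    by (rule eventually_at_right_prodE) (rule that)
qed

lemma abadie_cq_imp_normal_slope_ge_if_regular:
  fixes h :: "'a::euclidean_space \<Rightarrow> 'b::euclidean_space" and h' :: "'a \<Rightarrow> 'a \<Rightarrow>\<^sub>L 'b"
  assumes cont: "isCont h x" "isCont h' x"
    and acq: "\<forall>\<^sub>F s in nhds x. h s \<in> K \<longrightarrow> abadie_cq h K (h' s) s"
    and regular: "\<And>n. n \<in> normal_cone K (h x) \<Longrightarrow> adjoint (h' x) n = 0 \<Longrightarrow> n = 0"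
  obtains c where "c > 0" "\<forall>\<^sub>F s in nhds x. h s \<in> K \<longrightarrow> normal_slope_ge c h K (h' s) s"
proof -
  obtain c where "c > 0" and c: "\<forall>\<^sub>F s in nhds x. \<forall>n\<in>normal_cone K (h s).
      c * norm n \<le> norm (adjoint (h' s) n)"
    using eventually_norm_adjoint_ge[OF cont regular] by blast
  from acq c have "\<forall>\<^sub>F s in nhds x. h s \<in> K \<longrightarrow> normal_slope_ge c h K (h' s) s"
  proof eventually_elim
    case (elim s)
    have "\<exists>n\<in>normal_cone K (h s). norm n \<le> 1 \<and> c \<le> n \<bullet> h' s v"
      if s: "h s \<in> K" and v: "v \<in> normal_cone (h -` K) s" "norm v = 1" for v
    proof -
      obtain m where m: "m \<in> normal_cone K (h s)" "v = adjoint (h' s) m"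
        using elim(1) s v(1) unfolding abadie_cq_def by blast
      have "m \<noteq> 0"
        using v(2) m(2) by (auto simp: linear_0 linear_adjoint_blinfun)
      have "c * norm m \<le> 1"
        using elim(2) m v(2) by metis
      then have "c \<le> 1 / norm m"
        using \<open>m \<noteq> 0\<close> by (simp add: field_simps)
      also have "\<dots> = sgn m \<bullet> h' s v"
        using v(2) by (simp add: m(2) inner_sgn_blinfun_adjoint)
      finally show ?thesis
        using normal_cone_sgn[OF m(1)] \<open>m \<noteq> 0\<close>
        by (intro bexI[of _ "sgn m"]) (auto simp: norm_sgn)
    qed
    then show ?case
      by (simp add: normal_slope_ge_def)
  qed
  with \<open>c > 0\<close> show thesis
    by (rule that)
qed

lemma singular_normal_propagates:
  fixes h :: "'a::euclidean_space \<Rightarrow> 'b::euclidean_space"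
  assumes conc: "K_concave K h" and K: "cone K"
    and x: "h x \<in> K" "(h has_derivative A) (at x)"
    and s: "h s \<in> K" "(h has_derivative B) (at s)"
    and n: "n \<in> normal_cone K (h x)" "adjoint A n = 0"
  shows "n \<in> normal_cone K (h s)" "adjoint B n = 0"
proof -
  have nK: "n \<in> normal_cone K 0" "n \<bullet> h x = 0"
    using n(1) normal_cone_cone[OF K x(1)] by auto
  have "n \<bullet> A u = 0" for u
    using adjoint_clauses(2)[OF has_derivative_linear[OF x(2)], of n u] n(2) by simp
  then have nonneg: "0 \<le> n \<bullet> h y" for y
    using K_concave_inner_derivative_le[OF conc nK(1) x(2), of y] nK(2)
    by (simp add: inner_diff_right)
  have ns: "n \<bullet> h s = 0"
    using nonneg[of s] nK(1) s(1) by (force simp: normal_cone_def)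
  with nK(1) show "n \<in> normal_cone K (h s)"
    by (simp add: normal_cone_cone[OF K s(1)])
  have "(\<lambda>u. n \<bullet> B u) = (\<lambda>u. 0)"
    using has_derivative_inner_right[OF s(2), of n] nonneg ns
    by (intro differential_zero_maxmin[OF UNIV_I open_UNIV]) auto
  then have "adjoint B n \<bullet> adjoint B n = 0"
    by (metis adjoint_clauses(2) has_derivative_linear s(2))
  then show "adjoint B n = 0"
    by simp
qed

lemma smooth_cone_singular_imp_normal_slope_ge:
  fixes h :: "'a::euclidean_space \<Rightarrow> 'b::euclidean_space"
  assumes smooth: "smooth_cone K" and conc: "K_concave K h"
    and x: "h x \<in> K" "(h has_derivative A) (at x)"
    and n: "n \<in> normal_cone K (h x)" "adjoint A n = 0" "n \<noteq> 0"
    and s: "h s \<in> K" "h s \<noteq> 0" "(h has_derivative B) (at s)" "abadie_cq h K B s"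
  shows "normal_slope_ge c h K B s"
proof -
  have ns: "n \<in> normal_cone K (h s)" "adjoint B n = 0"
    using singular_normal_propagates[OF conc smooth_coneD(1)[OF smooth]] x s n by blast+
  have "adjoint B m = 0" if "m \<in> normal_cone K (h s)" for m
  proof -
    have "m \<in> span {n}"
      using smooth_cone_normal_cone_subset_span[OF smooth s(1,2) ns(1) n(3)] that by blast
    then obtain a where "m = a *\<^sub>R n"
      by (auto simp: span_singleton)
    with ns(2) show ?thesis
      using adjoint_linear[OF has_derivative_linear[OF s(3)]] by (simp add: linear_scale)
  qed
  then have "v = 0" if "v \<in> normal_cone (h -` K) s" for v
    using s(4) that unfolding abadie_cq_def by (metis imageE)
  then show ?thesis
    unfolding normal_slope_ge_def by force
qed

lemma smooth_cone_abadie_cq_imp_normal_slope_ge: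
  fixes h :: "'a::euclidean_space \<Rightarrow> 'b::euclidean_space" and h' :: "'a \<Rightarrow> 'a \<Rightarrow>\<^sub>L 'b"
  assumes smooth: "smooth_cone K" and conc: "K_concave K h"
    and der: "\<And>x. (h has_derivative h' x) (at x)" and cont: "isCont h' x"
    and x: "h x \<in> K"
    and acq: "\<forall>\<^sub>F s in nhds x. h s \<in> K \<longrightarrow> abadie_cq h K (h' s) s"
  obtains c where "c > 0" "\<forall>\<^sub>F s in nhds x. h s \<in> K \<longrightarrow> normal_slope_ge c h K (h' s) s"
proof (cases "\<forall>n\<in>normal_cone K (h x). adjoint (h' x) n = 0 \<longrightarrow> n = 0")
  case True
  then show thesis
    using abadie_cq_imp_normal_slope_ge_if_regular[OF has_derivative_continuous[OF der] cont acq]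
      that by blast
next
  case False
  then obtain n where n: "n \<in> normal_cone K (h x)" "adjoint (h' x) n = 0" "n \<noteq> 0"
    by blast
  obtain c where "c > 0" and fibre: "\<forall>\<^sub>F s in nhds x. h s = h x \<longrightarrow> normal_slope_ge c h K (h' s) s"
    using abadie_cq_imp_normal_slope_ge_on_fibre[OF cont] eventually_nhds_x_imp_x[OF acq] x by blast
  have "(h \<longlongrightarrow> h x) (nhds x)"
    using has_derivative_continuous[OF der] by (simp add: continuous_at tendsto_at_iff_tendsto_nhds)
  then have nonzero: "\<forall>\<^sub>F s in nhds x. h x \<noteq> 0 \<longrightarrow> h s \<noteq> 0"
    using tendsto_imp_eventually_ne by (cases "h x = 0") auto
  from acq fibre nonzero have "\<forall>\<^sub>F s in nhds x. h s \<in> K \<longrightarrow> normal_slope_ge c h K (h' s) s"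
  proof eventually_elim
    case (elim s)
    have "normal_slope_ge c h K (h' s) s" if s: "h s \<in> K" "h s \<noteq> h x"
    proof -
      have "h s \<noteq> 0"
        using elim(3) s(2) by metis
      then show ?thesis
        using smooth_cone_singular_imp_normal_slope_ge[OF smooth conc x der n s(1) _ der]
          elim(1) s(1) by blast
    qed
    with elim(2) show ?case
      by blast
  qed
  with \<open>c > 0\<close> show thesis
    by (rule that)
qed

theorem local_error_bound_iff_abadie_cq:
  fixes h :: "'a::euclidean_space \<Rightarrow> 'b::euclidean_space" and h' :: "'a \<Rightarrow> 'a \<Rightarrow>\<^sub>L 'b"
  assumes smooth: "smooth_cone K" and conc: "K_concave K h"
    and der: "\<And>x. (h has_derivative h' x) (at x)" and cont: "isCont h' x"
    and x: "h x \<in> K"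
  shows "local_error_bound h K x \<longleftrightarrow>
    (\<forall>\<^sub>F s in nhds x. h s \<in> K \<longrightarrow> abadie_cq h K (h' s) s)"
proof
  note K = smooth_coneD[OF smooth]
  show "\<forall>\<^sub>F s in nhds x. h s \<in> K \<longrightarrow> abadie_cq h K (h' s) s" if "local_error_bound h K x"
    using conc K(1,3) der that by (rule local_error_bound_imp_abadie_cq)
  assume "\<forall>\<^sub>F s in nhds x. h s \<in> K \<longrightarrow> abadie_cq h K (h' s) s"
  then obtain c where "c > 0" "\<forall>\<^sub>F s in nhds x. h s \<in> K \<longrightarrow> normal_slope_ge c h K (h' s) s"
    by (rule smooth_cone_abadie_cq_imp_normal_slope_ge[OF smooth conc der cont x])
  then show "local_error_bound h K x"
    by (rule normal_slope_ge_imp_local_error_bound[OF conc K der x])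
qed

theorem theorem2:
  fixes K :: "(real ^ 'm) set"
    and h :: "real ^ 'n \<Rightarrow> real ^ 'm"
    and h' :: "real ^ 'n \<Rightarrow> ((real ^ 'n) \<Rightarrow>\<^sub>L (real ^ 'm))"
    and S :: "(real ^ 'n) set"
    and xbar :: "real ^ 'n"
  assumes "smooth_cone K"
    and "\<And>x. (h has_derivative blinfun_apply (h' x)) (at x)"
    and "continuous_on UNIV h'"
    and "K_concave K h"
    and "S = {x. h x \<in> K}"
    and "S \<noteq> {}"
    and "xbar \<in> S"
  shows "local_error_bound h K xbar \<longleftrightarrow>
    (\<exists>U. open U \<and> xbar \<in> U \<and>
       (\<forall>x\<in>S \<inter> U. adjoint (blinfun_apply (h' x)) ` normal_cone K (h x) = normal_cone S x))"
proof -
  have S: "S = h -` K"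
    using assms(5) by auto
  have "isCont h' xbar"
    using assms(3) by (simp add: continuous_on_eq_continuous_at)
  then have "local_error_bound h K xbar \<longleftrightarrow>
      (\<forall>\<^sub>F x in nhds xbar. x \<in> S \<longrightarrow> adjoint (h' x) ` normal_cone K (h x) = normal_cone S x)"
    using local_error_bound_iff_abadie_cq[OF assms(1,4,2)] assms(7)
    by (simp add: S abadie_cq_def)
  also have "\<dots> \<longleftrightarrow> (\<exists>U. open U \<and> xbar \<in> U \<and>
      (\<forall>x\<in>S \<inter> U. adjoint (h' x) ` normal_cone K (h x) = normal_cone S x))"
    unfolding eventually_nhds by blast
  finally show ?thesis .
qed

end
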